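(* (i) Every finite set of nonnegative rational square matrices (of any common dimension) has the finiteness property if and only if every pair of binary square matrices (of any common dimension) has the finiteness property. (ii) Every finite set of rational square matrices (of any common dimension) has the finiteness property if and only if every pair of square matrices with entries in $\{0,1,-1\}$ (of any common dimension) has the finiteness property.
   Context: For a finite nonempty set $\Sigma\subset\mathbb{R}^{n\times n}$ and $t\ge 1$, let $\Sigma^t=\{A_1\cdots A_t : A_i\in\Sigma\}$ be the set of products of length $t$ of matrices from $\Sigma$. The joint spectral radius of $\Sigma$ is $\rho(\Sigma)=\limsup_{t\to\infty}\max\{\|A\|^{1/t}: A\in\Sigma^t\}$, which does not depend on the chosen matrix norm $\|\cdot\|$. For a single matrix $A$, $\rho(A)$ denotes its usual spectral radius. $\Sigma$ has the finiteness property if there exist $t\ge 1$ and a product $A\in\Sigma^t$ such that $\rho(\Sigma)=\rho(A)^{1/t}$. A binary matrix is a matrix with entries in $\{0,1\}$. *)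

theory Defs
  imports
    "Jordan_Normal_Form.Spectral_Radius"
    "HOL-Library.Extended_Real"
    "HOL-Library.Liminf_Limsup"
begin

text \<open>
  Matrices are those of the Jordan normal form library, so that the dimension can be
  quantified inside a formula; everything below is meant for dimension \<open>n > 0\<close>.
\<close>

definition mat_with_entries :: "nat \<Rightarrow> 'a set \<Rightarrow> 'a mat set" where
  "mat_with_entries n E = {A \<in> carrier_mat n n. elements_mat A \<subseteq> E}"

text \<open>
  The joint spectral radius does not depend on the matrix norm; we fix the operator norm
  induced by the maximum norm on vectors, i.e. the maximal absolute row sum.
\<close>

definition row_sum_norm :: "real mat \<Rightarrow> real" where
  "row_sum_norm A = Max ((\<lambda>i. \<Sum>j<dim_col A. \<bar>A $$ (i, j)\<bar>) ` {..<dim_row A})"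

definition products :: "nat \<Rightarrow> real mat set \<Rightarrow> nat \<Rightarrow> real mat set" where
  "products n S t = {foldr (*) As (1\<^sub>m n) | As. length As = t \<and> set As \<subseteq> S}"

text \<open>
  The limit superior is taken in the extended reals, where it always exists; for finite
  nonempty \<open>S\<close> it is finite. The value at \<open>t = 0\<close> is irrelevant.
\<close>

definition joint_spectral_radius :: "nat \<Rightarrow> real mat set \<Rightarrow> ereal" where
  "joint_spectral_radius n S =
     limsup (\<lambda>t. ereal (Max ((\<lambda>A. root t (row_sum_norm A)) ` products n S t)))"

text \<open>The spectral radius of a real matrix takes its complex eigenvalues into account.\<close>

definition real_spectral_radius :: "real mat \<Rightarrow> real" where
  "real_spectral_radius A = spectral_radius (map_mat complex_of_real A)"

definition finiteness_property :: "nat \<Rightarrow> real mat set \<Rightarrow> bool" where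
  "finiteness_property n S \<longleftrightarrow>
     (\<exists>t\<ge>1. \<exists>A\<in>products n S t.
        joint_spectral_radius n S = ereal (root t (real_spectral_radius A)))"

end

theory Submission
  imports Defs
begin

text \<open>
  Only the passage from pairs to arbitrary rational sets needs an argument; it combines two
  reductions. First, after multiplication by a common denominator \<open>q\<close> the entries are integers, and
  an integer \<open>a\<close> is spread over \<open>M \<ge> \<bar>a\<bar>\<close> copies of its column as \<open>\<bar>a\<bar>\<close> entries \<open>sgn a\<close>. Vectors
  that are constant on copies form an invariant subspace which contains the image, hence all
  eigenvectors for nonzero eigenvalues, and there the product acts as \<open>q\<^sup>t\<close> times the original one.
  Second, \<open>m\<close> matrices are simulated by two: a word of \<open>m\<close> letters encodes the choice of one
  matrix by the position of its first \<open>True\<close>, and a finite automaton with \<open>2 m\<close> states decodes it.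

  In both cases products of length \<open>t\<close> correspond to products of length \<open>t m\<close>: norms in the original
  set are dominated by norms in the new one, and nonzero eigenvalues of new products come from
  old products. Together with \<open>\<rho>(A)\<^bsup>1/t\<^esup> \<le> \<rho>(S)\<close> for \<open>A \<in> S\<^sup>t\<close> this carries the finiteness property back.
\<close>

section \<open>Products of matrices from a set\<close>

lemma foldr_mat_carrier:
  assumes "set As \<subseteq> carrier_mat n n"
  shows "foldr (*) As (1\<^sub>m n) \<in> carrier_mat n n"
  using assms by (induction As) (auto intro: mult_carrier_mat)

lemma foldr_mat_append:
  fixes As :: "'a::semiring_1 mat list"
  assumes "set As \<subseteq> carrier_mat n n" "set Bs \<subseteq> carrier_mat n n"
  shows "foldr (*) (As @ Bs) (1\<^sub>m n) = foldr (*) As (1\<^sub>m n) * foldr (*) Bs (1\<^sub>m n)"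
  using assms(1)
proof (induction As)
  case Nil
  then show ?case using foldr_mat_carrier[OF assms(2)] by simp
next
  case (Cons A As)
  then show ?case
    using assoc_mult_mat[of A n n "foldr (*) As (1\<^sub>m n)" n "foldr (*) Bs (1\<^sub>m n)" n]
      foldr_mat_carrier[OF assms(2)] foldr_mat_carrier[of As n] by simp
qed

lemma products_carrier:
  assumes "S \<subseteq> carrier_mat n n" "A \<in> products n S t"
  shows "A \<in> carrier_mat n n"
  using assms foldr_mat_carrier unfolding products_def by blast

lemma products_0: "products n S 0 = {1\<^sub>m n}"
  by (auto simp: products_def)

lemma products_1: "S \<subseteq> carrier_mat n n \<Longrightarrow> A \<in> S \<Longrightarrow> A \<in> products n S 1"
  by (auto simp: products_def intro!: exI[of _ "[A]"])

lemma products_mult: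
  assumes "S \<subseteq> carrier_mat n n" "A \<in> products n S s" "B \<in> products n S t"
  shows "A * B \<in> products n S (s + t)"
proof -
  obtain As Bs where "A = foldr (*) As (1\<^sub>m n)" "length As = s" "set As \<subseteq> S"
    "B = foldr (*) Bs (1\<^sub>m n)" "length Bs = t" "set Bs \<subseteq> S"
    using assms unfolding products_def by blast
  then show ?thesis
    using assms(1) foldr_mat_append[of As n Bs] unfolding products_def
    by (auto intro!: exI[of _ "As @ Bs"])
qed

lemma products_pow:
  assumes S: "S \<subseteq> carrier_mat n n" and A: "A \<in> products n S t"
  shows "A ^\<^sub>m k \<in> products n S (k * t)"
proof (induction k)
  case 0
  then show ?case using products_carrier[OF S A] by (simp add: products_0)
next
  case (Suc k)
  then show ?case using products_mult[OF S Suc A] by (simp add: add.commute)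
qed

lemma finite_products:
  assumes "finite S"
  shows "finite (products n S t)"
proof -
  have "products n S t = (\<lambda>As. foldr (*) As (1\<^sub>m n)) ` {As. set As \<subseteq> S \<and> length As = t}"
    unfolding products_def by blast
  then show ?thesis using finite_lists_length_eq[OF assms] by simp
qed

lemma products_nonempty:
  assumes "S \<noteq> {}"
  shows "products n S t \<noteq> {}"
proof -
  obtain A where "A \<in> S" using assms by blast
  then have "foldr (*) (replicate t A) (1\<^sub>m n) \<in> products n S t"
    unfolding products_def by (auto intro!: exI[of _ "replicate t A"])
  then show ?thesis by blast
qed

section \<open>Row sum norm and spectral radius of a single matrix\<close>

lemma row_sum_le_norm:
  "i < dim_row A \<Longrightarrow> (\<Sum>j<dim_col A. \<bar>A $$ (i, j)\<bar>) \<le> row_sum_norm A"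
  unfolding row_sum_norm_def by (rule Max_ge) auto

lemma row_sum_norm_attained:
  assumes "dim_row A > 0"
  obtains i where "i < dim_row A" "row_sum_norm A = (\<Sum>j<dim_col A. \<bar>A $$ (i, j)\<bar>)"
proof -
  have "row_sum_norm A \<in> (\<lambda>i. \<Sum>j<dim_col A. \<bar>A $$ (i, j)\<bar>) ` {..<dim_row A}"
    unfolding row_sum_norm_def using assms by (intro Max_in) auto
  then show ?thesis using that by auto
qed

text \<open>Evaluate the eigenvector equation at a coordinate where the eigenvector has maximal
  modulus, and divide by that modulus.\<close>

lemma eigenvalue_norm_le_row_sum_norm:
  assumes A: "A \<in> carrier_mat n n" and ev: "eigenvalue (map_mat complex_of_real A) l"
  shows "norm l \<le> row_sum_norm A"
proof -
  obtain v where v: "v \<in> carrier_vec n" "v \<noteq> 0\<^sub>v n"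
    and eq: "map_mat complex_of_real A *\<^sub>v v = l \<cdot>\<^sub>v v"
    using ev A unfolding eigenvalue_def eigenvector_def by auto
  obtain i0 where i0: "i0 < n" "v $ i0 \<noteq> 0" using v by (metis carrier_vecD eq_vecI index_zero_vec)
  define M where "M = Max ((\<lambda>i. norm (v $ i)) ` {..<n})"
  have "M \<in> (\<lambda>i. norm (v $ i)) ` {..<n}" unfolding M_def using i0 by (intro Max_in) auto
  then obtain i where i: "i < n" "M = norm (v $ i)" by auto
  have le: "norm (v $ j) \<le> M" if "j < n" for j unfolding M_def using that by (intro Max_ge) auto
  have pos: "M > 0" using le[OF i0(1)] i0(2) by (meson less_le_trans zero_less_norm_iff)
  have "l * v $ i = (map_mat complex_of_real A *\<^sub>v v) $ i" using eq i v by simp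
  also have "\<dots> = (\<Sum>j<n. complex_of_real (A $$ (i, j)) * v $ j)"
    using A v i by (simp add: scalar_prod_def lessThan_atLeast0)
  finally have "norm l * M = norm (\<Sum>j<n. complex_of_real (A $$ (i, j)) * v $ j)"
    using i by (metis norm_mult)
  also have "\<dots> \<le> (\<Sum>j<n. \<bar>A $$ (i, j)\<bar> * M)"
    by (rule order_trans[OF norm_sum])
      (auto intro!: sum_mono mult_left_mono le simp: norm_mult)
  also have "\<dots> = (\<Sum>j<n. \<bar>A $$ (i, j)\<bar>) * M" by (simp add: sum_distrib_right)
  finally have "norm l \<le> (\<Sum>j<n. \<bar>A $$ (i, j)\<bar>)" using pos by simp
  also have "\<dots> \<le> row_sum_norm A" using row_sum_le_norm[of i A] A i by auto
  finally show ?thesis .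
qed

lemma eigenvalue_le_real_spectral_radius:
  assumes "A \<in> carrier_mat n n" "eigenvalue (map_mat complex_of_real A) l"
  shows "norm l \<le> real_spectral_radius A"
proof -
  have "map_mat complex_of_real A \<in> carrier_mat n n" using assms by simp
  from spectral_radius_mem_max(2)[OF this eigenvalue_imp_nonzero_dim[OF this assms(2)]]
  show ?thesis using assms unfolding real_spectral_radius_def spectrum_def by auto
qed

lemma real_spectral_radius_attained:
  assumes "A \<in> carrier_mat n n" "n > 0"
  obtains l where "eigenvalue (map_mat complex_of_real A) l" "real_spectral_radius A = norm l"
proof -
  have "map_mat complex_of_real A \<in> carrier_mat n n" using assms by simp
  from spectral_radius_mem_max(1)[OF this assms(2)] that show ?thesis
    unfolding real_spectral_radius_def spectrum_def by auto
qed

lemma eigenvalue_pow: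
  fixes A :: "'a::field mat"
  assumes A: "A \<in> carrier_mat n n" and "eigenvalue A l"
  shows "eigenvalue (A ^\<^sub>m k) (l ^ k)"
proof -
  obtain v where v: "eigenvector A v l" using assms unfolding eigenvalue_def by blast
  then have "eigenvector (A ^\<^sub>m k) v (l ^ k)"
    using eigenvector_pow[OF A v, of k] A unfolding eigenvector_def
    by (auto simp: pow_mat_dim_square)
  then show ?thesis unfolding eigenvalue_def by blast
qed

lemma map_mat_of_real_pow:
  assumes "A \<in> carrier_mat n n"
  shows "map_mat complex_of_real (A ^\<^sub>m k) = map_mat complex_of_real A ^\<^sub>m k"
  by (rule of_real_hom.mat_hom_pow[OF assms])

lemma real_spectral_radius_pow_le:
  assumes A: "A \<in> carrier_mat n n" and n: "n > 0"
  shows "real_spectral_radius A ^ k \<le> row_sum_norm (A ^\<^sub>m k)"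
proof -
  obtain l where l: "eigenvalue (map_mat complex_of_real A) l" "real_spectral_radius A = norm l"
    using real_spectral_radius_attained[OF A n] .
  have "eigenvalue (map_mat complex_of_real (A ^\<^sub>m k)) (l ^ k)"
    using eigenvalue_pow[OF _ l(1)] A by (simp add: map_mat_of_real_pow)
  from eigenvalue_norm_le_row_sum_norm[OF pow_carrier_mat[OF A] this] l(2) show ?thesis
    by (simp add: norm_power)
qed

lemma real_spectral_radius_nonneg:
  assumes "A \<in> carrier_mat n n" "n > 0"
  shows "0 \<le> real_spectral_radius A"
proof -
  obtain l where "real_spectral_radius A = cmod l"
    using real_spectral_radius_attained[OF assms] .
  then show ?thesis by simp
qed

section \<open>Joint spectral radius and transfer of the finiteness property\<close>

text \<open>The powers of \<open>A\<close> have lengths that are multiples of \<open>t\<close>, and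
  their normalised norms are bounded below by the left-hand side; the limit superior along this
  subsequence is at most the full one.\<close>

lemma root_spectral_radius_le_joint:
  assumes S: "S \<subseteq> carrier_mat n n" "finite S" and n: "n > 0" and t: "t \<ge> 1"
    and A: "A \<in> products n S t"
  shows "ereal (root t (real_spectral_radius A)) \<le> joint_spectral_radius n S"
proof -
  let ?X = "\<lambda>t. ereal (Max ((\<lambda>A. root t (row_sum_norm A)) ` products n S t))"
  \<comment> \<open>\<open>Suc k\<close> keeps all lengths positive, since \<open>root 0\<close> is
    constantly zero.\<close>
  let ?r = "\<lambda>k. Suc k * t"
  have Ac: "A \<in> carrier_mat n n" using products_carrier[OF S(1) A] .
  have "strict_mono ?r" using t by (auto simp: strict_mono_def)
  have "ereal (root t (real_spectral_radius A)) \<le> (?X \<circ> ?r) k" for k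
  proof -
    have "root t (real_spectral_radius A) = root (?r k) (real_spectral_radius A ^ Suc k)"
      using t real_spectral_radius_nonneg[OF Ac n]
      by (simp only: mult.commute[of "Suc k"] real_root_mult_exp real_root_power_cancel)
    also have "\<dots> \<le> root (?r k) (row_sum_norm (A ^\<^sub>m Suc k))"
      using t by (intro real_root_le_mono real_spectral_radius_pow_le[OF Ac n]) simp
    also have "\<dots> \<le> Max ((\<lambda>A. root (?r k) (row_sum_norm A)) ` products n S (?r k))"
      using products_pow[OF S(1) A, of "Suc k"] finite_products[OF S(2)]
      by (intro Max_ge finite_imageI imageI) auto
    finally show ?thesis by simp
  qed
  then have "ereal (root t (real_spectral_radius A)) \<le> limsup (?X \<circ> ?r)"
    by (intro le_Limsup) auto
  also have "\<dots> \<le> limsup ?X" by (rule limsup_subseq_mono) fact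
  finally show ?thesis unfolding joint_spectral_radius_def .
qed

text \<open>Taking roots of order \<open>t\<close> in the domination bounds
  \<open>c * root t (row_sum_norm A)\<close> by the power \<open>m\<close> of
  \<open>root (t * m) (row_sum_norm W)\<close>, which is eventually below any number greater than
  \<open>r ^ m\<close>.\<close>

lemma joint_spectral_radius_le:
  assumes S: "S \<subseteq> carrier_mat n n" "finite S" "S \<noteq> {}" "n > 0"
    and S': "finite S'" and m: "m \<ge> 1" and c: "c > 0"
    and dom: "\<And>t A. A \<in> products n S t \<Longrightarrow>
      \<exists>W\<in>products n' S' (t * m). c ^ t * row_sum_norm A \<le> row_sum_norm W"
    and r: "joint_spectral_radius n' S' = ereal r" "r \<ge> 0"
  shows "joint_spectral_radius n S \<le> ereal (r ^ m / c)"
proof -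
  let ?M = "\<lambda>n S t. Max ((\<lambda>A. root t (row_sum_norm A)) ` products n S t)"
  \<comment> \<open>The strict margin turns the limit superior for \<open>S'\<close> into a bound
    valid at all large lengths; it is removed at the end by letting \<open>y\<close> tend to
    \<open>r ^ m / c\<close>.\<close>
  have "limsup (\<lambda>t. ereal (?M n S t)) \<le> ereal y" if y: "r ^ m / c < y" for y
  proof -
    have "r ^ m < c * y" using y c by (simp add: field_simps)
    then have "root m (r ^ m) < root m (c * y)" using m by (intro real_root_less_mono) auto
    then have "r < root m (c * y)" using m r(2) by (simp add: real_root_power_cancel)
    then have "eventually (\<lambda>t. ereal (?M n' S' t) < ereal (root m (c * y))) sequentially"
      using r(1) unfolding joint_spectral_radius_def by (intro Limsup_lessD) auto
    then obtain N where N: "\<And>t. t \<ge> N \<Longrightarrow> ?M n' S' t < root m (c * y)"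
      unfolding eventually_sequentially by auto
    \<comment> \<open>\<open>Suc N\<close> instead of \<open>N\<close> makes \<open>t\<close>
      positive, so that \<open>root t\<close> is a genuine root.\<close>
    have "ereal (?M n S t) \<le> ereal y" if t: "t \<ge> Suc N" for t
    proof -
      have "root t (row_sum_norm A) \<le> y" if A: "A \<in> products n S t" for A
      proof -
        obtain W where W: "W \<in> products n' S' (t * m)"
          "c ^ t * row_sum_norm A \<le> row_sum_norm W" using dom[OF A] by blast
        have "root m (c * root t (row_sum_norm A)) = root (t * m) (c ^ t * row_sum_norm A)"
          using t c by (simp add: real_root_mult real_root_mult_exp mult.commute[of t]
              real_root_power_cancel)
        also have "\<dots> \<le> root (t * m) (row_sum_norm W)"
          using W t m by (intro real_root_le_mono) auto
        also have "\<dots> \<le> ?M n' S' (t * m)"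
          using W finite_products[OF S'] by (intro Max_ge) auto
        also have "\<dots> < root m (c * y)"
        proof (rule N)
          have "N \<le> t * 1" using t by simp
          also have "\<dots> \<le> t * m" using m by (intro mult_le_mono2)
          finally show "N \<le> t * m" .
        qed
        finally show ?thesis using m c by simp
      qed
      then show ?thesis
        using finite_products[OF S(2)] products_nonempty[OF S(3)] by simp
    qed
    then show ?thesis
      by (intro Limsup_bounded) (auto simp: eventually_sequentially intro!: exI[of _ "Suc N"])
  qed
  then have "joint_spectral_radius n S \<le> ereal (r ^ m / c) + ereal e" if "e > 0" for e
    using that unfolding joint_spectral_radius_def by simp
  then show ?thesis by (rule ereal_le_epsilon2)
qed

text \<open>Domination of norms bounds the joint spectral radius of \<open>S\<close> from above by
  \<open>r ^ m / c\<close>, where \<open>r\<close> is that of \<open>S'\<close>. Pulling back an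
  eigenvalue gives a product over \<open>S\<close> whose normalised spectral radius reaches this
  bound; as it cannot exceed the joint spectral radius, equality follows.\<close>

lemma finiteness_property_transfer:
  assumes S: "S \<subseteq> carrier_mat n n" "finite S" "S \<noteq> {}" and n: "n > 0"
    and S': "S' \<subseteq> carrier_mat n' n'" "finite S'" and n': "n' > 0"
    and m: "m \<ge> 1" and c: "c > 0"
    and dom: "\<And>t A. A \<in> products n S t \<Longrightarrow>
      \<exists>W\<in>products n' S' (t * m). c ^ t * row_sum_norm A \<le> row_sum_norm W"
    and eig: "\<And>t W l. t \<ge> 1 \<Longrightarrow> W \<in> products n' S' (t * m) \<Longrightarrow>
      eigenvalue (map_mat complex_of_real W) l \<Longrightarrow> l \<noteq> 0 \<Longrightarrow>
      \<exists>A\<in>products n S t. norm l \<le> c ^ t * real_spectral_radius A"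
    and fp: "finiteness_property n' S'"
  shows "finiteness_property n S"
proof -
  obtain t W where t: "t \<ge> 1" and W: "W \<in> products n' S' t"
    and jsr': "joint_spectral_radius n' S' = ereal (root t (real_spectral_radius W))"
    using fp unfolding finiteness_property_def by blast
  define r where "r = root t (real_spectral_radius W)"
  have Wc: "W \<in> carrier_mat n' n'" using products_carrier[OF S'(1) W] .
  have W0: "0 \<le> real_spectral_radius W" using real_spectral_radius_nonneg[OF Wc n'] .
  then have r0: "r \<ge> 0" unfolding r_def using t by simp
  have rt: "r ^ t = real_spectral_radius W" unfolding r_def using t W0 by simp
  have upper: "joint_spectral_radius n S \<le> ereal (r ^ m / c)"
    using joint_spectral_radius_le[OF S n S'(2) m c dom jsr'[folded r_def] r0] .
  have "\<exists>s\<ge>1. \<exists>A\<in>products n S s. r ^ m / c \<le> root s (real_spectral_radius A)"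
  \<comment> \<open>If \<open>r = 0\<close>, there is no nonzero eigenvalue to pull back, but the
    bound is zero and any product of length one reaches it.\<close>
  proof (cases "r = 0")
    case True
    obtain A where A: "A \<in> products n S 1" using products_nonempty[OF S(3), of n 1] by blast
    have "r ^ m / c \<le> root 1 (real_spectral_radius A)"
      using real_spectral_radius_nonneg[OF products_carrier[OF S(1) A] n] True m
      by (simp add: power_0_left)
    then show ?thesis using A by blast
  next
    case False
    obtain l where l: "eigenvalue (map_mat complex_of_real W) l" "real_spectral_radius W = norm l"
      using real_spectral_radius_attained[OF Wc n'] .
    have "l \<noteq> 0" using l(2) rt False t by auto
    \<comment> \<open>The length \<open>t\<close> need not be a multiple of \<open>m\<close>, so
      \<open>W\<close> is replaced by its power \<open>m\<close>, which has length
      \<open>t * m\<close>.\<close>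
    have "eigenvalue (map_mat complex_of_real (W ^\<^sub>m m)) (l ^ m)"
      using eigenvalue_pow[OF _ l(1)] Wc by (simp add: map_mat_of_real_pow)
    moreover have "W ^\<^sub>m m \<in> products n' S' (t * m)"
      using products_pow[OF S'(1) W, of m] by (simp add: mult.commute)
    ultimately obtain A where A: "A \<in> products n S t"
      and le: "norm (l ^ m) \<le> c ^ t * real_spectral_radius A"
      using eig[OF t] \<open>l \<noteq> 0\<close> by (metis power_not_zero)
    have "norm (l ^ m) = (r ^ m) ^ t"
      by (simp add: norm_power l(2)[symmetric] rt[symmetric] power_mult[symmetric] mult.commute)
    then have "(r ^ m / c) ^ t \<le> real_spectral_radius A"
      using le c by (simp add: power_divide field_simps)
    then have "root t ((r ^ m / c) ^ t) \<le> root t (real_spectral_radius A)"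
      using t by (intro real_root_le_mono) auto
    then have "r ^ m / c \<le> root t (real_spectral_radius A)"
      using t r0 c by (simp add: real_root_power_cancel)
    then show ?thesis using t A by blast
  qed
  then obtain s A where s: "s \<ge> 1" and A: "A \<in> products n S s"
    and le: "r ^ m / c \<le> root s (real_spectral_radius A)" by blast
  have "joint_spectral_radius n S = ereal (root s (real_spectral_radius A))"
    using upper le root_spectral_radius_le_joint[OF S(1,2) n s A]
    by (meson antisym ereal_less_eq(3) order_trans)
  then show ?thesis unfolding finiteness_property_def using s A by blast
qed

section \<open>Indices split into blocks\<close>

lemma sum_div_mod:
  fixes f :: "nat \<Rightarrow> nat \<Rightarrow> 'a::comm_monoid_add"
  shows "(\<Sum>k<p * n. f (k div n) (k mod n)) = (\<Sum>s<p. \<Sum>j<n. f s j)"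
proof -
  have "(\<Sum>k<p * n. f (k div n) (k mod n)) = (\<Sum>s<p. \<Sum>k = s * n..<s * n + n. f (k div n) (k mod n))"
    by (rule sum.nat_group[symmetric])
  also have "\<dots> = (\<Sum>s<p. \<Sum>j<n. f s j)"
  proof (rule sum.cong[OF refl])
    fix s
    have "(\<Sum>k = 0 + s * n..<n + s * n. f (k div n) (k mod n)) =
        (\<Sum>j = 0..<n. f ((j + s * n) div n) ((j + s * n) mod n))"
      by (rule sum.shift_bounds_nat_ivl)
    also have "\<dots> = (\<Sum>j = 0..<n. f s j)" by (rule sum.cong) auto
    finally show "(\<Sum>k = s * n..<s * n + n. f (k div n) (k mod n)) = (\<Sum>j<n. f s j)"
      by (simp add: add.commute lessThan_atLeast0)
  qed
  finally show ?thesis .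
qed

lemma sum_div_mod_single:
  fixes f :: "nat \<Rightarrow> 'a::comm_monoid_add"
  assumes "a < p"
  shows "(\<Sum>k<p * n. if k div n = a then f (k mod n) else 0) = (\<Sum>j<n. f j)"
proof -
  have "(\<Sum>k<p * n. if k div n = a then f (k mod n) else 0) =
      (\<Sum>s<p. \<Sum>j<n. if s = a then f j else 0)"
    by (rule sum_div_mod[of "\<lambda>s j. if s = a then f j else 0"])
  also have "\<dots> = (\<Sum>s<p. if s = a then \<Sum>j<n. f j else 0)" by (intro sum.cong) auto
  finally show ?thesis using assms by simp
qed

lemma div_mod_less:
  fixes r p n :: nat
  assumes "r < p * n"
  shows "r div n < p" "r mod n < n"
proof -
  show "r div n < p" by (rule less_mult_imp_div_less[OF assms])
  show "r mod n < n" using assms by (cases n) simp_all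
qed

section \<open>From rational entries to the entries 0, 1 and -1\<close>

text \<open>An entry depends on its row only through \<open>r div M\<close>, so the image consists
  of vectors constant on copies. Only the columns are spread: summing over a group of them restores
  the scaled entry if it is an integer of absolute value at most \<open>M\<close>.\<close>

definition copy_mat :: "real \<Rightarrow> nat \<Rightarrow> real mat \<Rightarrow> real mat" where
  "copy_mat q M A = mat (dim_row A * M) (dim_row A * M) (\<lambda>(r, c).
     if real (c mod M) < \<bar>q * A $$ (r div M, c div M)\<bar> then sgn (q * A $$ (r div M, c div M)) else 0)"

lemma copy_mat_carrier [simp]: "A \<in> carrier_mat n n \<Longrightarrow> copy_mat q M A \<in> carrier_mat (n * M) (n * M)"
  by (simp add: copy_mat_def)

text \<open>For an integer \<open>x\<close>, exactly \<open>\<bar>x\<bar>\<close> of the indices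
  below \<open>M\<close> pass the test, and each contributes the sign.\<close>

lemma sum_sgn_copies:
  fixes x :: real
  assumes "x \<in> \<int>" "\<bar>x\<bar> \<le> real M"
  shows "(\<Sum>d<M. if real d < \<bar>x\<bar> then sgn x else 0) = x"
proof -
  obtain k :: int where k: "x = of_int k" using assms(1) by (elim Ints_cases)
  have "{d. d < M \<and> real d < \<bar>x\<bar>} = {..<nat \<bar>k\<bar>}" using assms(2) k by (auto; linarith)
  then have "(\<Sum>d<M. if real d < \<bar>x\<bar> then sgn x else 0) = (\<Sum>d\<in>{..<nat \<bar>k\<bar>}. sgn x)"
    by (subst sum.inter_filter[symmetric]) (auto simp: lessThan_def)
  also have "\<dots> = \<bar>x\<bar> * sgn x" by (simp add: k)
  finally show ?thesis by (simp add: abs_mult_sgn)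
qed

text \<open>
  Equivalently \<open>W E = E A\<close>, where \<open>E\<close> is the \<open>n M \<times> n\<close> matrix that repeats every coordinate \<open>M\<close> times.
\<close>

definition copies_of :: "nat \<Rightarrow> nat \<Rightarrow> real mat \<Rightarrow> real mat \<Rightarrow> bool" where
  "copies_of n M A W \<longleftrightarrow>
     (\<forall>r<n * M. \<forall>j<n. (\<Sum>d<M. W $$ (r, j * M + d)) = A $$ (r div M, j))"

lemma index_block_less:
  fixes j M d n :: nat
  assumes "j < n" "d < M"
  shows "j * M + d < n * M"
proof -
  have "j * M + d < Suc j * M" using assms by simp
  also have "\<dots> \<le> n * M" using assms by (intro mult_le_mono1) auto
  finally show ?thesis .
qed

lemma copies_of_one: "copies_of n M (1\<^sub>m n) (1\<^sub>m (n * M))"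
proof -
  have "(\<Sum>d<M. 1\<^sub>m (n * M) $$ (r, j * M + d)) = (1\<^sub>m n $$ (r div M, j) :: real)"
    if r: "r < n * M" and j: "j < n" for r j
  proof -
    have "(\<Sum>d<M. 1\<^sub>m (n * M) $$ (r, j * M + d)) =
        (\<Sum>d<M. if d = r mod M then (if r div M = j then 1 else 0) else (0::real))"
    proof (rule sum.cong[OF refl])
      fix d assume d: "d \<in> {..<M}"
      have "r = j * M + d \<longleftrightarrow> d = r mod M \<and> r div M = j"
        using d by (auto simp: div_mult_mod_eq)
      then show "1\<^sub>m (n * M) $$ (r, j * M + d) =
          (if d = r mod M then (if r div M = j then 1 else 0) else (0::real))"
        using r index_block_less[OF j, of d M] d by simp
    qed
    also have "\<dots> = (1\<^sub>m n $$ (r div M, j) :: real)"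
      using div_mod_less[OF r] j by simp
    finally show ?thesis .
  qed
  then show ?thesis unfolding copies_of_def by blast
qed

text \<open>In terms of the repetition matrix \<open>E\<close> this is
  \<open>V W E = V E B = E A B\<close>.\<close>

lemma copies_of_mult:
  assumes A: "A \<in> carrier_mat n n" "B \<in> carrier_mat n n"
    and V: "V \<in> carrier_mat (n * M) (n * M)" "W \<in> carrier_mat (n * M) (n * M)"
    and AV: "copies_of n M A V" and BW: "copies_of n M B W"
  shows "copies_of n M (A * B) (V * W)"
proof -
  have "(\<Sum>d<M. (V * W) $$ (r, j * M + d)) = (A * B) $$ (r div M, j)"
    if r: "r < n * M" and j: "j < n" for r j
  proof -
    have "(\<Sum>d<M. (V * W) $$ (r, j * M + d)) =
        (\<Sum>d<M. \<Sum>k<n * M. V $$ (r, k) * W $$ (k, j * M + d))"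
      using V r index_block_less[OF j] by (intro sum.cong)
        (auto simp: scalar_prod_def lessThan_atLeast0)
    also have "\<dots> = (\<Sum>k<n * M. V $$ (r, k) * (\<Sum>d<M. W $$ (k, j * M + d)))"
      by (subst sum.swap) (simp add: sum_distrib_left)
    also have "\<dots> = (\<Sum>k<n * M. V $$ (r, (k div M) * M + k mod M) * B $$ (k div M, j))"
      using BW j unfolding copies_of_def by (intro sum.cong) auto
    also have "\<dots> = (\<Sum>i<n. \<Sum>e<M. V $$ (r, i * M + e) * B $$ (i, j))"
      by (rule sum_div_mod[of "\<lambda>i e. V $$ (r, i * M + e) * B $$ (i, j)"])
    also have "\<dots> = (\<Sum>i<n. A $$ (r div M, i) * B $$ (i, j))"
      using AV r unfolding copies_of_def
      by (intro sum.cong) (auto simp: sum_distrib_right[symmetric])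
    also have "\<dots> = (A * B) $$ (r div M, j)"
      using A j div_mod_less[OF r] by (simp add: scalar_prod_def lessThan_atLeast0)
    finally show ?thesis .
  qed
  then show ?thesis unfolding copies_of_def by blast
qed

lemma copies_of_copy_mat:
  assumes A: "A \<in> carrier_mat n n"
    and int: "\<And>i j. i < n \<Longrightarrow> j < n \<Longrightarrow> q * A $$ (i, j) \<in> \<int> \<and> \<bar>q * A $$ (i, j)\<bar> \<le> real M"
  shows "copies_of n M (q \<cdot>\<^sub>m A) (copy_mat q M A)"
proof -
  have "(\<Sum>d<M. copy_mat q M A $$ (r, j * M + d)) = (q \<cdot>\<^sub>m A) $$ (r div M, j)"
    if r: "r < n * M" and j: "j < n" for r j
  proof -
    let ?x = "q * A $$ (r div M, j)"
    have "(\<Sum>d<M. copy_mat q M A $$ (r, j * M + d)) = (\<Sum>d<M. if real d < \<bar>?x\<bar> then sgn ?x else 0)"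
      using A r index_block_less[OF j] by (intro sum.cong) (auto simp: copy_mat_def)
    also have "\<dots> = ?x" using int[OF div_mod_less(1)[OF r] j] by (intro sum_sgn_copies) auto
    finally show ?thesis using A j div_mod_less[OF r] by simp
  qed
  then show ?thesis unfolding copies_of_def by blast
qed

lemma copies_of_foldr:
  assumes As: "set As \<subseteq> carrier_mat n n"
    and int: "\<And>A i j. A \<in> set As \<Longrightarrow> i < n \<Longrightarrow> j < n \<Longrightarrow>
      q * A $$ (i, j) \<in> \<int> \<and> \<bar>q * A $$ (i, j)\<bar> \<le> real M"
  shows "copies_of n M (q ^ length As \<cdot>\<^sub>m foldr (*) As (1\<^sub>m n))
    (foldr (*) (map (copy_mat q M) As) (1\<^sub>m (n * M)))"
  using assms
proof (induction As)
  case Nil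
  have "(1::real) \<cdot>\<^sub>m 1\<^sub>m n = 1\<^sub>m n" by (intro eq_matI) auto
  then show ?case using copies_of_one by simp
next
  case (Cons A As)
  let ?P = "foldr (*) As (1\<^sub>m n)"
  let ?W = "foldr (*) (map (copy_mat q M) As) (1\<^sub>m (n * M))"
  have A: "A \<in> carrier_mat n n" and P: "?P \<in> carrier_mat n n"
    using Cons.prems(1) foldr_mat_carrier[of As n] by auto
  have "?W \<in> carrier_mat (n * M) (n * M)"
    using Cons.prems(1) by (intro foldr_mat_carrier) auto
  then have "copies_of n M ((q \<cdot>\<^sub>m A) * (q ^ length As \<cdot>\<^sub>m ?P)) (copy_mat q M A * ?W)"
    using Cons A P by (intro copies_of_mult copies_of_copy_mat) auto
  moreover have "(q \<cdot>\<^sub>m A) * (q ^ length As \<cdot>\<^sub>m ?P) = q ^ length (A # As) \<cdot>\<^sub>m (A * ?P)"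
  proof -
    have "(q \<cdot>\<^sub>m A) * (q ^ length As \<cdot>\<^sub>m ?P) = q \<cdot>\<^sub>m (q ^ length As \<cdot>\<^sub>m (A * ?P))"
      using mult_smult_assoc_mat[OF A smult_carrier_mat[OF P]] mult_smult_distrib[OF A P] by simp
    also have "\<dots> = q ^ length (A # As) \<cdot>\<^sub>m (A * ?P)" by (intro eq_matI) simp_all
    finally show ?thesis .
  qed
  ultimately show ?case by simp
qed

text \<open>Row \<open>i\<close> of \<open>A\<close> arises from row \<open>i * M\<close> of
  \<open>W\<close> by summing within groups of columns, which cannot increase the sum of absolute
  values.\<close>

lemma copies_of_norm:
  assumes A: "A \<in> carrier_mat n n" and W: "W \<in> carrier_mat (n * M) (n * M)"
    and n: "n > 0" "M > 0" and AW: "copies_of n M A W"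
  shows "row_sum_norm A \<le> row_sum_norm W"
proof -
  obtain i where i: "i < n" "row_sum_norm A = (\<Sum>j<n. \<bar>A $$ (i, j)\<bar>)"
    using row_sum_norm_attained[of A] A n by auto
  have iM: "i * M < n * M" using i n by simp
  have "row_sum_norm A = (\<Sum>j<n. \<bar>\<Sum>d<M. W $$ (i * M, j * M + d)\<bar>)"
    using AW iM n unfolding i(2) copies_of_def by (intro sum.cong) auto
  also have "\<dots> \<le> (\<Sum>j<n. \<Sum>d<M. \<bar>W $$ (i * M, j * M + d)\<bar>)"
    by (intro sum_mono sum_abs)
  also have "\<dots> = (\<Sum>k<n * M. \<bar>W $$ (i * M, (k div M) * M + k mod M)\<bar>)"
    by (rule sum_div_mod[symmetric, of "\<lambda>j d. \<bar>W $$ (i * M, j * M + d)\<bar>"])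
  also have "\<dots> = (\<Sum>k<dim_col W. \<bar>W $$ (i * M, k)\<bar>)" using W by simp
  also have "\<dots> \<le> row_sum_norm W" using W iM by (intro row_sum_le_norm) auto
  finally show ?thesis .
qed

lemma eigenvalue_smult:
  fixes A :: "'a::field mat"
  assumes A: "A \<in> carrier_mat n n" and c: "c \<noteq> 0" and ev: "eigenvalue (c \<cdot>\<^sub>m A) l"
  shows "eigenvalue A (l / c)"
proof -
  obtain v where v: "v \<in> carrier_vec n" "v \<noteq> 0\<^sub>v n" "(c \<cdot>\<^sub>m A) *\<^sub>v v = l \<cdot>\<^sub>v v"
    using ev A unfolding eigenvalue_def eigenvector_def by auto
  have "A *\<^sub>v v = (l / c) \<cdot>\<^sub>v v"
  proof (intro eq_vecI)
    fix i assume "i < dim_vec ((l / c) \<cdot>\<^sub>v v)"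
    then have i: "i < n" using v by simp
    have "((c \<cdot>\<^sub>m A) *\<^sub>v v) $ i = c * (A *\<^sub>v v) $ i"
      using A v(1) i by (simp add: scalar_prod_def sum_distrib_left mult.assoc)
    then have "c * (A *\<^sub>v v) $ i = l * v $ i" using v i by simp
    then show "(A *\<^sub>v v) $ i = ((l / c) \<cdot>\<^sub>v v) $ i" using c v i by (simp add: field_simps)
  qed (use A v in auto)
  then show ?thesis using A v unfolding eigenvalue_def eigenvector_def by auto
qed

text \<open>As rows agree inside a group, \<open>W v = l v\<close> with nonzero \<open>l\<close>
  makes \<open>v\<close> constant on copies. Hence \<open>v = E w\<close> for a vector
  \<open>w\<close> with \<open>n\<close> coordinates, and \<open>W E = E A\<close> turns the
  equation into \<open>A w = l w\<close>.\<close>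

lemma copies_of_eigenvalue:
  assumes A: "A \<in> carrier_mat n n" and W: "W \<in> carrier_mat (n * M) (n * M)"
    and M: "M > 0" and AW: "copies_of n M A W"
    and rows: "\<And>r k. r < n * M \<Longrightarrow> k < n * M \<Longrightarrow> W $$ (r, k) = W $$ (r div M * M, k)"
    and ev: "eigenvalue (map_mat complex_of_real W) l" and l: "l \<noteq> 0"
  shows "eigenvalue (map_mat complex_of_real A) l"
proof -
  obtain v where v: "v \<in> carrier_vec (n * M)" "v \<noteq> 0\<^sub>v (n * M)"
    and eq: "map_mat complex_of_real W *\<^sub>v v = l \<cdot>\<^sub>v v"
    using ev W unfolding eigenvalue_def eigenvector_def by auto
  have comp: "l * v $ r = (\<Sum>k<n * M. of_real (W $$ (r, k)) * v $ k)" if "r < n * M" for r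
  proof -
    have "l * v $ r = (map_mat complex_of_real W *\<^sub>v v) $ r" using eq v that by simp
    then show ?thesis using W v that by (simp add: scalar_prod_def lessThan_atLeast0)
  qed
  have const: "v $ r = v $ (r div M * M)" if r: "r < n * M" for r
  proof -
    have r': "r div M * M < n * M" using div_mod_less[OF r] M by simp
    have "l * v $ r = l * v $ (r div M * M)"
      unfolding comp[OF r] comp[OF r'] using rows[OF r] by (intro sum.cong) auto
    then show ?thesis using l by simp
  qed
  define w where "w = vec n (\<lambda>i. v $ (i * M))"
  have "map_mat complex_of_real A *\<^sub>v w = l \<cdot>\<^sub>v w"
  proof (intro eq_vecI)
    fix i assume "i < dim_vec (l \<cdot>\<^sub>v w)"
    then have i: "i < n" by (simp add: w_def)
    then have iM: "i * M < n * M" using M by simp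
    have "(l \<cdot>\<^sub>v w) $ i = (\<Sum>k<n * M. of_real (W $$ (i * M, k)) * v $ k)"
      using i comp[OF iM] by (simp add: w_def)
    also have "\<dots> = (\<Sum>k<n * M. of_real (W $$ (i * M, k div M * M + k mod M)) * v $ (k div M * M))"
      unfolding div_mult_mod_eq by (intro sum.cong refl arg_cong2[of _ _ _ _ "(*)"] const) simp
    also have "\<dots> = (\<Sum>j<n. \<Sum>d<M. of_real (W $$ (i * M, j * M + d)) * v $ (j * M))"
      by (rule sum_div_mod[of "\<lambda>j d. of_real (W $$ (i * M, j * M + d)) * v $ (j * M)"])
    also have "\<dots> = (\<Sum>j<n. of_real (\<Sum>d<M. W $$ (i * M, j * M + d)) * v $ (j * M))"
      by (simp add: sum_distrib_right)
    also have "\<dots> = (\<Sum>j<n. of_real (A $$ (i, j)) * v $ (j * M))"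
      using AW iM M unfolding copies_of_def by (intro sum.cong) auto
    also have "\<dots> = (map_mat complex_of_real A *\<^sub>v w) $ i"
      using A i by (simp add: w_def scalar_prod_def lessThan_atLeast0)
    finally show "(map_mat complex_of_real A *\<^sub>v w) $ i = (l \<cdot>\<^sub>v w) $ i" by simp
  qed (use A in \<open>simp add: w_def\<close>)
  moreover have "w \<noteq> 0\<^sub>v n"
  proof
    assume w0: "w = 0\<^sub>v n"
    have "v = 0\<^sub>v (n * M)"
    proof (intro eq_vecI)
      fix r assume "r < dim_vec (0\<^sub>v (n * M) :: complex vec)"
      then have r: "r < n * M" by simp
      then have "v $ r = w $ (r div M)" using const[OF r] div_mod_less[OF r] by (simp add: w_def)
      then show "v $ r = 0\<^sub>v (n * M) $ r" using w0 div_mod_less[OF r] r by simp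
    qed (use v in simp)
    then show False using v by simp
  qed
  moreover have "w \<in> carrier_vec n" by (simp add: w_def)
  ultimately have "eigenvector (map_mat complex_of_real A) w l"
    using A unfolding eigenvector_def by simp
  then show ?thesis unfolding eigenvalue_def by blast
qed

text \<open>The rows of the left factor agree inside a group of copies, and this passes to the
  product. It supplies the hypothesis on rows in \<open>copies_of_eigenvalue\<close>.\<close>

lemma copy_mat_mult_rows:
  assumes A: "A \<in> carrier_mat n n" and W: "W \<in> carrier_mat (n * M) (n * M)"
    and r: "r < n * M" and k: "k < n * M"
  shows "(copy_mat q M A * W) $$ (r, k) = (copy_mat q M A * W) $$ (r div M * M, k)"
proof -
  have M: "M > 0" using r by (cases M) auto
  have r': "r div M * M < n * M" using div_mod_less[OF r] M by simp
  have "row (copy_mat q M A) r = row (copy_mat q M A) (r div M * M)"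
    using A r r' M by (intro eq_vecI) (auto simp: copy_mat_def)
  moreover have "dim_row (copy_mat q M A) = n * M" using A by (simp add: copy_mat_def)
  ultimately show ?thesis using W r r' k by simp
qed

lemma words_over_image:
  assumes "set xs \<subseteq> f ` S"
  obtains ys where "xs = map f ys" "set ys \<subseteq> S"
proof -
  have "xs \<in> map f ` lists S"
    using assms by (simp add: lists_image[symmetric] in_lists_conv_set subset_iff)
  then show ?thesis using that by (auto simp: lists_eq_set)
qed

text \<open>The transfer with \<open>m = 1\<close> and \<open>c = q\<close>: factor by factor, a
  product of \<open>t\<close> copied matrices corresponds to \<open>q ^ t\<close> times the product
  of the originals.\<close>

lemma finiteness_property_copy_mat:
  assumes S: "S \<subseteq> carrier_mat n n" "finite S" "S \<noteq> {}" and n: "n > 0" "M > 0" "q > 0"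
    and int: "\<And>A i j. A \<in> S \<Longrightarrow> i < n \<Longrightarrow> j < n \<Longrightarrow>
      q * A $$ (i, j) \<in> \<int> \<and> \<bar>q * A $$ (i, j)\<bar> \<le> real M"
    and fp: "finiteness_property (n * M) (copy_mat q M ` S)"
  shows "finiteness_property n S"
proof (rule finiteness_property_transfer[OF S n(1) _ _ _ order_refl n(3) _ _ fp])
  show S': "copy_mat q M ` S \<subseteq> carrier_mat (n * M) (n * M)" using S by auto
  show "finite (copy_mat q M ` S)" "0 < n * M" using S n by auto
  have cop: "copies_of n M (q ^ length As \<cdot>\<^sub>m foldr (*) As (1\<^sub>m n))
      (foldr (*) (map (copy_mat q M) As) (1\<^sub>m (n * M)))" if "set As \<subseteq> S" for As
    using that S(1) int by (intro copies_of_foldr) blast+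
  show "\<exists>W\<in>products (n * M) (copy_mat q M ` S) (t * 1). q ^ t * row_sum_norm A \<le> row_sum_norm W"
    if A: "A \<in> products n S t" for t A
  proof -
    obtain As where As: "A = foldr (*) As (1\<^sub>m n)" "length As = t" "set As \<subseteq> S"
      using A unfolding products_def by blast
    let ?W = "foldr (*) (map (copy_mat q M) As) (1\<^sub>m (n * M))"
    have W: "?W \<in> products (n * M) (copy_mat q M ` S) (t * 1)"
      using As image_mono[OF As(3), of "copy_mat q M"] unfolding products_def
      by (auto intro!: exI[of _ "map (copy_mat q M) As"])
    have Ac: "A \<in> carrier_mat n n" using products_carrier[OF S(1) A] .
    have "copies_of n M (q ^ t \<cdot>\<^sub>m A) ?W"
      using cop[OF As(3)] As by simp
    then have "row_sum_norm (q ^ t \<cdot>\<^sub>m A) \<le> row_sum_norm ?W"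
      using Ac products_carrier[OF S' W] n by (intro copies_of_norm) auto
    moreover have "q ^ t * row_sum_norm A \<le> row_sum_norm (q ^ t \<cdot>\<^sub>m A)"
    proof -
      obtain i where i: "i < n" "row_sum_norm A = (\<Sum>j<n. \<bar>A $$ (i, j)\<bar>)"
        using row_sum_norm_attained[of A] Ac n by auto
      have "q ^ t * row_sum_norm A = (\<Sum>j<n. \<bar>(q ^ t \<cdot>\<^sub>m A) $$ (i, j)\<bar>)"
        using i Ac n by (simp add: sum_distrib_left abs_mult)
      also have "\<dots> \<le> row_sum_norm (q ^ t \<cdot>\<^sub>m A)"
        using row_sum_le_norm[of i "q ^ t \<cdot>\<^sub>m A"] Ac i by simp
      finally show ?thesis .
    qed
    ultimately have "q ^ t * row_sum_norm A \<le> row_sum_norm ?W" by (rule order_trans[rotated])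
    then show ?thesis using W by blast
  qed
  show "\<exists>A\<in>products n S t. norm l \<le> q ^ t * real_spectral_radius A"
    if t: "1 \<le> t" and W: "W \<in> products (n * M) (copy_mat q M ` S) (t * 1)"
      and ev: "eigenvalue (map_mat complex_of_real W) l" and l: "l \<noteq> 0" for t W l
  proof -
    obtain Ws where Ws: "W = foldr (*) Ws (1\<^sub>m (n * M))" "length Ws = t" "set Ws \<subseteq> copy_mat q M ` S"
      using W unfolding products_def by auto
    obtain As where As: "Ws = map (copy_mat q M) As" "set As \<subseteq> S"
      using words_over_image[OF Ws(3)] .
    let ?A = "foldr (*) As (1\<^sub>m n)"
    have len: "length As = t" using Ws(2) As by simp
    have A: "?A \<in> products n S t" using As len unfolding products_def by blast
    have Ac: "?A \<in> carrier_mat n n" using products_carrier[OF S(1) A] .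
    \<comment> \<open>\<open>1 \<le> t\<close> provides a first factor, which makes rows agree
      inside groups; the empty product is the identity, where this fails in general.\<close>
    obtain B Bs where B: "As = B # Bs" using len t by (cases As) auto
    have "foldr (*) (map (copy_mat q M) Bs) (1\<^sub>m (n * M)) \<in> carrier_mat (n * M) (n * M)"
      using As(2) B S(1) by (intro foldr_mat_carrier) auto
    then have rows: "W $$ (r, k) = W $$ (r div M * M, k)" if "r < n * M" "k < n * M" for r k
      using copy_mat_mult_rows[of B n _ M r k q] that As B Ws(1) S(1) by auto
    have Wc: "W \<in> carrier_mat (n * M) (n * M)" using products_carrier[OF S' W] .
    have "copies_of n M (q ^ t \<cdot>\<^sub>m ?A) W" using cop[OF As(2)] As(1) len Ws(1) by simp
    with Ac have "eigenvalue (map_mat complex_of_real (q ^ t \<cdot>\<^sub>m ?A)) l"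
      by (intro copies_of_eigenvalue[OF _ Wc n(2) _ rows ev l] smult_carrier_mat)
    moreover have "map_mat complex_of_real (q ^ t \<cdot>\<^sub>m ?A) = of_real (q ^ t) \<cdot>\<^sub>m map_mat complex_of_real ?A"
      by (intro eq_matI) auto
    ultimately have "eigenvalue (map_mat complex_of_real ?A) (l / of_real (q ^ t))"
      using Ac n(3) by (intro eigenvalue_smult[where n = n]) auto
    from eigenvalue_le_real_spectral_radius[OF Ac this]
    have "norm l \<le> q ^ t * real_spectral_radius ?A"
      using n(3) by (simp add: norm_divide norm_power field_simps)
    then show ?thesis using A by blast
  qed
qed

section \<open>Block matrices that run an automaton\<close>

text \<open>
  Acts on block vectors by \<open>(B v)\<^sub>s = L(s) v\<^bsub>\<delta>(s)\<^esub>\<close>, so a product of such matrices, read from left to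
  right, runs the automaton and multiplies the labels met on the way.
\<close>

definition automaton_mat :: "nat \<Rightarrow> nat \<Rightarrow> (nat \<Rightarrow> real mat) \<Rightarrow> (nat \<Rightarrow> nat) \<Rightarrow> real mat" where
  "automaton_mat n p L \<delta> = mat (p * n) (p * n) (\<lambda>(r, c).
     if c div n = \<delta> (r div n) then L (r div n) $$ (r mod n, c mod n) else 0)"

lemma automaton_mat_carrier [simp]: "automaton_mat n p L \<delta> \<in> carrier_mat (p * n) (p * n)"
  by (simp add: automaton_mat_def)

lemma automaton_mat_dim [simp]:
  "dim_row (automaton_mat n p L \<delta>) = p * n" "dim_col (automaton_mat n p L \<delta>) = p * n"
  by (simp_all add: automaton_mat_def)

lemma automaton_mat_id: "automaton_mat n p (\<lambda>s. 1\<^sub>m n) (\<lambda>s. s) = 1\<^sub>m (p * n)"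
proof (intro eq_matI)
  fix r c assume "r < dim_row (1\<^sub>m (p * n) :: real mat)" "c < dim_col (1\<^sub>m (p * n) :: real mat)"
  then have rc: "r < p * n" "c < p * n" by simp_all
  have "r = c \<longleftrightarrow> c div n = r div n \<and> r mod n = c mod n" by (metis div_mult_mod_eq)
  then show "automaton_mat n p (\<lambda>s. 1\<^sub>m n) (\<lambda>s. s) $$ (r, c) = 1\<^sub>m (p * n) $$ (r, c)"
    using rc div_mod_less[OF rc(1)] div_mod_less[OF rc(2)] by (auto simp: automaton_mat_def)
qed simp_all

lemma automaton_mat_mult:
  assumes L: "\<And>s. s < p \<Longrightarrow> L s \<in> carrier_mat n n" "\<And>s. s < p \<Longrightarrow> L' s \<in> carrier_mat n n"
    and \<delta>: "\<And>s. s < p \<Longrightarrow> \<delta> s < p"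
  shows "automaton_mat n p L \<delta> * automaton_mat n p L' \<delta>' =
    automaton_mat n p (\<lambda>s. L s * L' (\<delta> s)) (\<lambda>s. \<delta>' (\<delta> s))"
proof (intro eq_matI)
  fix r c assume "r < dim_row (automaton_mat n p (\<lambda>s. L s * L' (\<delta> s)) (\<lambda>s. \<delta>' (\<delta> s)))"
    "c < dim_col (automaton_mat n p (\<lambda>s. L s * L' (\<delta> s)) (\<lambda>s. \<delta>' (\<delta> s)))"
  then have rc: "r < p * n" "c < p * n" by simp_all
  note r = div_mod_less[OF rc(1)]
  note c = div_mod_less[OF rc(2)]
  let ?s = "r div n"
  let ?f = "\<lambda>j. L ?s $$ (r mod n, j) *
    (if c div n = \<delta>' (\<delta> ?s) then L' (\<delta> ?s) $$ (j, c mod n) else 0)"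
  have "(automaton_mat n p L \<delta> * automaton_mat n p L' \<delta>') $$ (r, c) =
      (\<Sum>k<p * n. automaton_mat n p L \<delta> $$ (r, k) * automaton_mat n p L' \<delta>' $$ (k, c))"
    using rc by (simp add: scalar_prod_def lessThan_atLeast0)
  \<comment> \<open>In block row \<open>s\<close> of the left factor only the columns of block
    \<open>\<delta> s\<close> can be nonzero.\<close>
  also have "\<dots> = (\<Sum>k<p * n. if k div n = \<delta> ?s then ?f (k mod n) else 0)"
    using rc by (intro sum.cong) (auto simp: automaton_mat_def)
  also have "\<dots> = (\<Sum>j<n. ?f j)" by (rule sum_div_mod_single) (rule \<delta>[OF r(1)])
  also have "\<dots> = (if c div n = \<delta>' (\<delta> ?s) then (L ?s * L' (\<delta> ?s)) $$ (r mod n, c mod n) else 0)"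
    using L(1)[OF r(1)] L(2)[OF \<delta>[OF r(1)]] r c
    by (auto simp: scalar_prod_def lessThan_atLeast0)
  also have "\<dots> = automaton_mat n p (\<lambda>s. L s * L' (\<delta> s)) (\<lambda>s. \<delta>' (\<delta> s)) $$ (r, c)"
    using rc by (simp add: automaton_mat_def)
  finally show "(automaton_mat n p L \<delta> * automaton_mat n p L' \<delta>') $$ (r, c) =
    automaton_mat n p (\<lambda>s. L s * L' (\<delta> s)) (\<lambda>s. \<delta>' (\<delta> s)) $$ (r, c)" .
qed simp_all

definition vec_block :: "nat \<Rightarrow> nat \<Rightarrow> 'a vec \<Rightarrow> 'a vec" where
  "vec_block n s v = vec n (\<lambda>i. v $ (s * n + i))"

lemma vec_block_automaton_mat:
  assumes v: "v \<in> carrier_vec (p * n)" and s: "s < p" "\<delta> s < p" and L: "L s \<in> carrier_mat n n"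
  shows "vec_block n s (map_mat complex_of_real (automaton_mat n p L \<delta>) *\<^sub>v v) =
    map_mat complex_of_real (L s) *\<^sub>v vec_block n (\<delta> s) v"
proof (intro eq_vecI)
  fix i assume "i < dim_vec (map_mat complex_of_real (L s) *\<^sub>v vec_block n (\<delta> s) v)"
  then have i: "i < n" using L by simp
  then have r: "s * n + i < p * n" using index_block_less[OF s(1) i] by simp
  let ?f = "\<lambda>j. of_real (L s $$ (i, j)) * v $ (\<delta> s * n + j)"
  have "(map_mat complex_of_real (automaton_mat n p L \<delta>) *\<^sub>v v) $ (s * n + i) =
      (\<Sum>k<p * n. of_real (automaton_mat n p L \<delta> $$ (s * n + i, k)) * v $ k)"
    using v r by (simp add: scalar_prod_def lessThan_atLeast0)
  also have "\<dots> = (\<Sum>k<p * n. if k div n = \<delta> s then ?f (k mod n) else 0)"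
  proof (rule sum.cong[OF refl])
    fix k assume k: "k \<in> {..<p * n}"
    have "v $ k = v $ (\<delta> s * n + k mod n)" if "k div n = \<delta> s"
      using that by (metis div_mult_mod_eq)
    then show "of_real (automaton_mat n p L \<delta> $$ (s * n + i, k)) * v $ k =
        (if k div n = \<delta> s then ?f (k mod n) else 0)"
      using k r i by (auto simp: automaton_mat_def)
  qed
  also have "\<dots> = (\<Sum>j<n. ?f j)" by (rule sum_div_mod_single) (rule s)
  also have "\<dots> = (map_mat complex_of_real (L s) *\<^sub>v vec_block n (\<delta> s) v) $ i"
    using L i by (simp add: vec_block_def scalar_prod_def lessThan_atLeast0)
  finally show "vec_block n s (map_mat complex_of_real (automaton_mat n p L \<delta>) *\<^sub>v v) $ i =
      (map_mat complex_of_real (L s) *\<^sub>v vec_block n (\<delta> s) v) $ i"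
    using i by (simp add: vec_block_def)
qed (use L in \<open>simp add: vec_block_def\<close>)

lemma vec_block_nonzero:
  assumes v: "v \<in> carrier_vec (p * n)" "v \<noteq> 0\<^sub>v (p * n)"
  obtains s where "s < p" "vec_block n s v \<noteq> 0\<^sub>v n"
proof -
  obtain r where r: "r < p * n" "v $ r \<noteq> 0" using v by (metis carrier_vecD eq_vecI index_zero_vec)
  note d = div_mod_less[OF r(1)]
  have "vec_block n (r div n) v $ (r mod n) = v $ r" using d by (simp add: vec_block_def)
  then have "vec_block n (r div n) v \<noteq> 0\<^sub>v n" using r(2) d by (metis index_zero_vec(1))
  then show ?thesis using that d by blast
qed

section \<open>An automaton decoding Boolean words\<close>

text \<open>
  State \<open>s < m\<close>: at position \<open>s\<close> of the current block of \<open>m\<close> letters, no matrix selected yet.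
  State \<open>m + s\<close>: at position \<open>s\<close>, waiting for the end of the block.
  The first letter \<open>True\<close>, or else the last letter, selects the matrix given by its position.
\<close>

definition next_state :: "nat \<Rightarrow> bool \<Rightarrow> nat \<Rightarrow> nat" where
  "next_state m b s = (if Suc (s mod m) = m then 0
     else if b \<or> m \<le> s then m + Suc (s mod m) else Suc s)"

definition label :: "nat \<Rightarrow> real mat list \<Rightarrow> bool \<Rightarrow> nat \<Rightarrow> real mat" where
  "label n As b s = (if s < length As \<and> (b \<or> Suc s = length As) then As ! s else 1\<^sub>m n)"

primrec run :: "nat \<Rightarrow> bool list \<Rightarrow> nat \<Rightarrow> nat" where
  "run m [] s = s"
| "run m (b # w) s = run m w (next_state m b s)"

primrec block_output :: "nat \<Rightarrow> real mat list \<Rightarrow> bool list \<Rightarrow> nat \<Rightarrow> real mat" where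
  "block_output n As [] s = 1\<^sub>m n"
| "block_output n As (b # w) s = label n As b s * block_output n As w (next_state (length As) b s)"

definition letter_mat :: "nat \<Rightarrow> real mat list \<Rightarrow> bool \<Rightarrow> real mat" where
  "letter_mat n As b = automaton_mat n (2 * length As) (label n As b) (next_state (length As) b)"

lemma letter_mat_carrier: "letter_mat n As b \<in> carrier_mat (2 * length As * n) (2 * length As * n)"
  by (simp add: letter_mat_def)

lemma next_state_less: "m > 0 \<Longrightarrow> s < 2 * m \<Longrightarrow> next_state m b s < 2 * m"
  by (auto simp: next_state_def intro!: Suc_lessI)

lemma run_less: "m > 0 \<Longrightarrow> s < 2 * m \<Longrightarrow> run m w s < 2 * m"
  by (induction w arbitrary: s) (auto simp: next_state_less)

lemma run_append: "run m (v @ w) s = run m w (run m v s)"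
  by (induction v arbitrary: s) auto

lemma label_carrier: "set As \<subseteq> carrier_mat n n \<Longrightarrow> label n As b s \<in> carrier_mat n n"
  by (auto simp: label_def)

lemma block_output_carrier: "set As \<subseteq> carrier_mat n n \<Longrightarrow> block_output n As w s \<in> carrier_mat n n"
  by (induction w arbitrary: s) (auto intro!: mult_carrier_mat label_carrier)

lemma block_output_append:
  assumes "set As \<subseteq> carrier_mat n n"
  shows "block_output n As (v @ w) s = block_output n As v s * block_output n As w (run (length As) v s)"
proof (induction v arbitrary: s)
  case Nil
  then show ?case using left_mult_one_mat[OF block_output_carrier[OF assms]] by simp
next
  case (Cons b v)
  then show ?case
    using assoc_mult_mat[OF label_carrier[OF assms] block_output_carrier[OF assms] block_output_carrier[OF assms]]
    by simp
qed

text \<open>Automaton matrices are closed under products, so a whole word acts as a single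
  transition with a single label per state. Statements on products thereby become statements on
  runs.\<close>

lemma foldr_letter_mat:
  assumes As: "set As \<subseteq> carrier_mat n n" "As \<noteq> []"
  shows "foldr (*) (map (letter_mat n As) w) (1\<^sub>m (2 * length As * n)) =
    automaton_mat n (2 * length As) (block_output n As w) (run (length As) w)"
proof (induction w)
  case Nil
  then show ?case using automaton_mat_id[of n "2 * length As"] by simp
next
  case (Cons b w)
  then show ?case
    using As automaton_mat_mult[of "2 * length As" "label n As b" n "block_output n As w"
        "next_state (length As) b" "run (length As) w"]
    by (simp add: letter_mat_def label_carrier block_output_carrier next_state_less)
qed

text \<open>Waiting states have identity labels, and the position reaches the end of the block after
  \<open>m - s\<close> letters. A general \<open>s\<close> is needed for the induction and because
  waiting may begin at any position after the first.\<close>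

lemma run_block_waiting:
  assumes "set As \<subseteq> carrier_mat n n" "s < m" "length w = m - s" "m = length As"
  shows "run m w (m + s) = 0 \<and> block_output n As w (m + s) = 1\<^sub>m n"
  using assms(2,3)
proof (induction w arbitrary: s)
  case Nil
  then show ?case by simp
next
  case (Cons b w)
  show ?case
  proof (cases "Suc s = m")
    case True
    then have "w = []" using Cons.prems by (cases w) auto
    then show ?thesis using True assms(4) by (simp add: next_state_def label_def)
  next
    case False
    then have "run m w (m + Suc s) = 0 \<and> block_output n As w (m + Suc s) = 1\<^sub>m n"
      using Cons.prems by (intro Cons.IH) auto
    then show ?thesis using Cons.prems False assms(4) by (simp add: next_state_def label_def)
  qed
qed

text \<open>Exactly one of the remaining letters of the block contributes a member of
  \<open>As\<close>; the labels at all other letters are identities.\<close>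

lemma run_block_choosing:
  assumes "set As \<subseteq> carrier_mat n n" "s < m" "length w = m - s" "m = length As"
  shows "run m w s = 0 \<and> block_output n As w s \<in> set As"
  using assms(2,3)
proof (induction w arbitrary: s)
  case Nil
  then show ?case by simp
next
  case (Cons b w)
  have mem: "As ! s \<in> set As" using Cons.prems assms(4) by simp
  then have c: "As ! s \<in> carrier_mat n n" using assms(1) by blast
  \<comment> \<open>The first case is the default: the last position selects its matrix whatever the
    letter is, so a block consisting of \<open>False\<close> only selects one too.\<close>
  consider "Suc s = m" | "Suc s < m" "b" | "Suc s < m" "\<not> b" using Cons.prems by linarith
  then show ?case
  proof cases
    case 1
    then have "w = []" using Cons.prems by (cases w) auto
    then show ?thesis using 1 assms(4) mem c by (simp add: next_state_def label_def)
  next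
    case 2
    then have "run m w (m + Suc s) = 0 \<and> block_output n As w (m + Suc s) = 1\<^sub>m n"
      using Cons.prems assms by (intro run_block_waiting) auto
    then show ?thesis using 2 assms(4) mem c by (simp add: next_state_def label_def)
  next
    case 3
    then have IH: "run m w (Suc s) = 0 \<and> block_output n As w (Suc s) \<in> set As"
      using Cons.prems by (intro Cons.IH) auto
    then have "block_output n As w (Suc s) \<in> carrier_mat n n" using assms(1) by blast
    then show ?thesis using 3 IH assms(4) by (simp add: next_state_def label_def)
  qed
qed

text \<open>In both phases \<open>s mod m\<close> is the position inside the block, so
  \<open>m - s mod m\<close> letters complete it.\<close>

lemma run_block_end:
  fixes As :: "real mat list"
  assumes "set As \<subseteq> carrier_mat n n" "m = length As" "s < 2 * m" "length w = m - s mod m"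
  shows "run m w s = 0"
proof (cases "s < m")
  case True
  then show ?thesis using run_block_choosing[of As n s m w] assms by simp
next
  case False
  then have "s mod m = s - m" using assms(3) by (simp add: mod_if)
  then show ?thesis using False run_block_waiting[of As n "s - m" m w] assms by simp
qed

text \<open>The letters \<open>False\<close> pass over \<open>k\<close> positions with identity
  labels, \<open>True\<close> selects, and \<open>w\<close> is read while waiting.\<close>

lemma block_output_select:
  assumes "set As \<subseteq> carrier_mat n n" "m = length As" "k < m - s" "length w = m - s - Suc k"
  shows "block_output n As (replicate k False @ True # w) s = As ! (s + k)"
  using assms(3,4)
proof (induction k arbitrary: s)
  case 0
  have "As ! s \<in> set As" using 0 assms(2) by simp
  then have c: "As ! s \<in> carrier_mat n n" using assms(1) by blast
  show ?case
  proof (cases "Suc s = m")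
    case True
    then show ?thesis using 0 c assms(2) by (simp add: next_state_def label_def)
  next
    case False
    then have "block_output n As w (m + Suc s) = 1\<^sub>m n"
      using 0 assms run_block_waiting[of As n "Suc s" m w] by simp
    then show ?thesis using 0 False c assms(2) by (simp add: next_state_def label_def)
  qed
next
  case (Suc k)
  have "As ! (Suc s + k) \<in> set As" using Suc.prems assms(2) by simp
  then have c: "As ! (Suc s + k) \<in> carrier_mat n n" using assms(1) by blast
  have "block_output n As (replicate k False @ True # w) (Suc s) = As ! (Suc s + k)"
    using Suc.prems by (intro Suc.IH) auto
  moreover have "Suc s < m" using Suc.prems by simp
  ultimately show ?case using c assms(2) by (simp add: next_state_def label_def)
qed

text \<open>Each block of \<open>length As\<close> letters leads from state \<open>0\<close> back to
  state \<open>0\<close> and outputs one matrix.\<close>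

lemma block_output_blocks:
  assumes As: "set As \<subseteq> carrier_mat n n" "As \<noteq> []" and "length w = t * length As"
  shows "run (length As) w 0 = 0 \<and> block_output n As w 0 \<in> products n (set As) t"
  using assms(3)
proof (induction t arbitrary: w)
  case 0
  then show ?case by (simp add: products_0)
next
  case (Suc t)
  define x y where "x = take (length As) w" and "y = drop (length As) w"
  have w: "w = x @ y" by (simp add: x_def y_def)
  have len: "length x = length As" "length y = t * length As"
    using Suc.prems by (simp_all add: x_def y_def)
  have x: "run (length As) x 0 = 0" "block_output n As x 0 \<in> set As"
    using run_block_choosing[of As n 0 "length As" x] As len by auto
  have "block_output n As x 0 * block_output n As y 0 \<in> products n (set As) (1 + t)"
    using products_mult[OF As(1) products_1[OF As(1) x(2)]] Suc.IH[OF len(2)] by blast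
  then show ?case using x Suc.IH[OF len(2)] by (simp add: w run_append block_output_append[OF As(1)])
qed

text \<open>Converse to \<open>block_output_blocks\<close>: each factor is encoded by a block of its
  own. This gives the domination of norms.\<close>

lemma blocks_exist:
  assumes As: "set As \<subseteq> carrier_mat n n" "As \<noteq> []" and Bs: "set Bs \<subseteq> set As"
  shows "\<exists>w. length w = length Bs * length As \<and> block_output n As w 0 = foldr (*) Bs (1\<^sub>m n)"
  using Bs
proof (induction Bs)
  case Nil
  then show ?case by simp
next
  case (Cons B Bs)
  then obtain w where w: "length w = length Bs * length As" "block_output n As w 0 = foldr (*) Bs (1\<^sub>m n)"
    by auto
  obtain k where k: "k < length As" "B = As ! k" using Cons.prems by (auto simp: in_set_conv_nth)
  \<comment> \<open>The letters after \<open>True\<close> only fill the block.\<close>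
  define x where "x = replicate k False @ True # replicate (length As - Suc k) False"
  have len: "length x = length As" using k by (simp add: x_def)
  have "block_output n As x 0 = B"
    using block_output_select[of As n "length As" k 0] As k by (simp add: x_def)
  moreover have "run (length As) x 0 = 0"
    using run_block_choosing[of As n 0 "length As" x] As len by auto
  ultimately have "block_output n As (x @ w) 0 = foldr (*) (B # Bs) (1\<^sub>m n)"
    using w by (simp add: block_output_append[OF As(1)])
  then show ?case using w len by (intro exI[of _ "x @ w"]) simp
qed

section \<open>Norms and eigenvalues for the two letter matrices\<close>

text \<open>State \<open>0\<close> is fixed by \<open>\<delta>\<close>, so \<open>L 0\<close> is a
  diagonal block and the remaining entries of its rows vanish.\<close>

lemma automaton_mat_norm:
  assumes L: "L 0 \<in> carrier_mat n n" and \<delta>: "\<delta> 0 = 0" and p: "p > 0" "n > 0"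
  shows "row_sum_norm (L 0) \<le> row_sum_norm (automaton_mat n p L \<delta>)"
proof -
  obtain i where i: "i < n" "row_sum_norm (L 0) = (\<Sum>j<n. \<bar>L 0 $$ (i, j)\<bar>)"
    using row_sum_norm_attained[of "L 0"] L p by auto
  have "0 * n + i < p * n" using index_block_less[OF p(1) i(1)] .
  then have r: "i < p * n" by simp
  have "row_sum_norm (L 0) = (\<Sum>k<p * n. if k div n = 0 then \<bar>L 0 $$ (i, k mod n)\<bar> else 0)"
    unfolding i(2) by (rule sum_div_mod_single[symmetric]) (rule p)
  also have "\<dots> = (\<Sum>k<p * n. \<bar>automaton_mat n p L \<delta> $$ (i, k)\<bar>)"
    using r i(1) \<delta> by (intro sum.cong) (auto simp: automaton_mat_def)
  also have "\<dots> \<le> row_sum_norm (automaton_mat n p L \<delta>)"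
    using row_sum_le_norm[of i "automaton_mat n p L \<delta>"] r by simp
  finally show ?thesis .
qed

lemma mult_mat_vec_zero:
  fixes A :: "real mat"
  assumes "A \<in> carrier_mat n n"
  shows "map_mat complex_of_real A *\<^sub>v 0\<^sub>v n = 0\<^sub>v n"
  using assms by (intro eq_vecI) (auto simp: scalar_prod_def)

text \<open>
  An eigenvector of the matrix of \<open>w\<close> may vanish on the block of state \<open>0\<close>. If its block \<open>s\<close> does not
  vanish, split \<open>w = x y\<close> where \<open>x\<close> leads from \<open>s\<close> to \<open>0\<close>; applying \<open>y\<close> yields an eigenvector
  for the rotated word \<open>y x\<close> that does not vanish on block \<open>0\<close>.
\<close>

lemma letter_mat_eigenvalue:
  assumes As: "set As \<subseteq> carrier_mat n n" "As \<noteq> []"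
    and w: "length w = t * length As" "t \<ge> 1"
    and ev: "eigenvalue (map_mat complex_of_real
      (foldr (*) (map (letter_mat n As) w) (1\<^sub>m (2 * length As * n)))) l" and l: "l \<noteq> 0"
  shows "\<exists>A\<in>products n (set As) t. eigenvalue (map_mat complex_of_real A) l"
proof -
  define m where "m = length As"
  define p where "p = 2 * m"
  have m: "m > 0" "p > 0" using As by (simp_all add: m_def p_def)
  define W where "W = (\<lambda>w. map_mat complex_of_real (automaton_mat n p (block_output n As w) (run m w)))"
  have Wc [simp]: "W w \<in> carrier_mat (p * n) (p * n)" for w unfolding W_def by simp
  have W_append: "W (x @ y) = W x * W y" for x y
  proof -
    have "block_output n As (x @ y) = (\<lambda>s. block_output n As x s * block_output n As y (run m x s))"
      "run m (x @ y) = (\<lambda>s. run m y (run m x s))"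
      by (intro ext; simp add: m_def run_append block_output_append[OF As(1)])+
    then have "automaton_mat n p (block_output n As (x @ y)) (run m (x @ y)) =
        automaton_mat n p (block_output n As x) (run m x) * automaton_mat n p (block_output n As y) (run m y)"
      using automaton_mat_mult[of p "block_output n As x" n "block_output n As y" "run m x" "run m y"]
        block_output_carrier[OF As(1)] run_less[OF m(1)]
      by (simp add: p_def)
    then show ?thesis unfolding W_def
      by (simp add: of_real_hom.mat_hom_mult[OF automaton_mat_carrier automaton_mat_carrier])
  qed
  have block: "vec_block n s (W x *\<^sub>v v) =
      map_mat complex_of_real (block_output n As x s) *\<^sub>v vec_block n (run m x s) v"
    if "s < p" "v \<in> carrier_vec (p * n)" for s v x
    using that vec_block_automaton_mat[of v p n s "run m x" "block_output n As x"]
      run_less[OF m(1)] block_output_carrier[OF As(1)] unfolding W_def p_def by simp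
  obtain v where v: "v \<in> carrier_vec (p * n)" "v \<noteq> 0\<^sub>v (p * n)" "W w *\<^sub>v v = l \<cdot>\<^sub>v v"
    using ev unfolding foldr_letter_mat[OF As] eigenvalue_def eigenvector_def
    by (auto simp: W_def p_def m_def)
  obtain s where s: "s < p" "vec_block n s v \<noteq> 0\<^sub>v n" using vec_block_nonzero[OF v(1,2)] .
  define x y where "x = take (m - s mod m) w" and "y = drop (m - s mod m) w"
  have wxy: "w = x @ y" by (simp add: x_def y_def)
  have "m \<le> length w" using w by (simp add: m_def)
  then have "length x = m - s mod m" by (simp add: x_def)
  then have x0: "run m x s = 0" using run_block_end[of As n m s x] As s(1) by (simp add: m_def p_def)
  define u where "u = W y *\<^sub>v v"
  have u: "u \<in> carrier_vec (p * n)" using mult_mat_vec_carrier[OF Wc v(1)] by (simp add: u_def)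
  have Wxu: "W x *\<^sub>v u = l \<cdot>\<^sub>v v"
    using v(3) assoc_mult_mat_vec[OF Wc Wc v(1), of x y] by (simp add: u_def wxy W_append)
  have "vec_block n s (l \<cdot>\<^sub>v v) = l \<cdot>\<^sub>v vec_block n s v"
    using v(1) index_block_less[OF s(1)] by (intro eq_vecI) (auto simp: vec_block_def)
  then have xu: "map_mat complex_of_real (block_output n As x s) *\<^sub>v vec_block n 0 u = l \<cdot>\<^sub>v vec_block n s v"
    using block[OF s(1) u, of x] x0 Wxu by simp
  have u0: "vec_block n 0 u \<noteq> 0\<^sub>v n"
  proof
    assume "vec_block n 0 u = 0\<^sub>v n"
    then have z: "l \<cdot>\<^sub>v vec_block n s v = 0\<^sub>v n"
      using xu mult_mat_vec_zero[OF block_output_carrier[OF As(1)]] by simp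
    have "vec_block n s v = 0\<^sub>v n"
    proof (intro eq_vecI)
      fix i assume "i < dim_vec (0\<^sub>v n :: complex vec)"
      then have i: "i < n" by simp
      then have "(l \<cdot>\<^sub>v vec_block n s v) $ i = l * vec_block n s v $ i" by (simp add: vec_block_def)
      then show "vec_block n s v $ i = 0\<^sub>v n $ i" using z l i by simp
    qed (simp add: vec_block_def)
    then show False using s(2) by simp
  qed
  \<comment> \<open>Rotation keeps the eigenvalue: \<open>W x\<close> maps \<open>u\<close> to
    \<open>l v\<close>, and \<open>W y\<close> maps \<open>v\<close> to \<open>u\<close>.\<close>
  have "W (y @ x) *\<^sub>v u = W y *\<^sub>v (l \<cdot>\<^sub>v v)"
    using assoc_mult_mat_vec[OF Wc Wc u, of y x] Wxu by (simp add: W_append)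
  also have "\<dots> = l \<cdot>\<^sub>v u" using mult_mat_vec[OF Wc v(1)] by (simp add: u_def)
  finally have Wyx: "W (y @ x) *\<^sub>v u = l \<cdot>\<^sub>v u" .
  \<comment> \<open>The rotated word still consists of \<open>t\<close> full blocks, hence fixes
    state \<open>0\<close>, and block \<open>0\<close> of the eigenvector equation involves only
    block \<open>0\<close> of \<open>u\<close>.\<close>
  have "length (y @ x) = t * length As" using w(1) by (simp add: wxy)
  note yx = block_output_blocks[OF As this]
  have "vec_block n 0 (l \<cdot>\<^sub>v u) = l \<cdot>\<^sub>v vec_block n 0 u"
    using u index_block_less[OF m(2)] by (intro eq_vecI) (auto simp: vec_block_def)
  then have "map_mat complex_of_real (block_output n As (y @ x) 0) *\<^sub>v vec_block n 0 u = l \<cdot>\<^sub>v vec_block n 0 u"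
    using block[OF m(2) u, of "y @ x"] yx Wyx by (simp add: m_def)
  then have "eigenvalue (map_mat complex_of_real (block_output n As (y @ x) 0)) l"
    using u0 block_output_carrier[OF As(1), of "y @ x" 0] unfolding eigenvalue_def eigenvector_def
    by (intro exI[of _ "vec_block n 0 u"]) (auto simp: vec_block_def)
  then show ?thesis using yx by blast
qed

text \<open>The transfer with \<open>m = length As\<close> and \<open>c = 1\<close>. Norms are
  dominated because the output from state \<open>0\<close> is a diagonal block; eigenvalues come
  back by \<open>letter_mat_eigenvalue\<close>.\<close>

lemma finiteness_property_letter_mat:
  assumes As: "set As \<subseteq> carrier_mat n n" "As \<noteq> []" and n: "n > 0"
    and fp: "finiteness_property (2 * length As * n) {letter_mat n As False, letter_mat n As True}"
  shows "finiteness_property n (set As)"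
proof -
  \<comment> \<open>As a range, the pair has products indexed by Boolean words, and two equal letter
    matrices need no separate treatment.\<close>
  have rng: "range (letter_mat n As) = {letter_mat n As False, letter_mat n As True}"
    by (auto simp: UNIV_bool)
  let ?N = "2 * length As * n"
  let ?S = "range (letter_mat n As)"
  have foldr_mem: "foldr (*) (map (letter_mat n As) w) (1\<^sub>m ?N) \<in> products ?N ?S (length w)" for w
    unfolding products_def by (auto intro!: exI[of _ "map (letter_mat n As) w"])
  have foldr_ex: "\<exists>w. length w = t \<and> W = foldr (*) (map (letter_mat n As) w) (1\<^sub>m ?N)"
    if W: "W \<in> products ?N ?S t" for W t
  proof -
    obtain Ws where Ws: "W = foldr (*) Ws (1\<^sub>m ?N)" "length Ws = t" "set Ws \<subseteq> ?S"
      using W unfolding products_def by auto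
    obtain w where "Ws = map (letter_mat n As) w" using words_over_image[OF Ws(3)] .
    then show ?thesis using Ws by auto
  qed
  show ?thesis
  proof (rule finiteness_property_transfer[where n' = ?N and S' = ?S and m = "length As" and c = 1])
    show "\<exists>W\<in>products ?N ?S (t * length As). 1 ^ t * row_sum_norm A \<le> row_sum_norm W"
      if A: "A \<in> products n (set As) t" for t A
    proof -
      obtain Bs where Bs: "A = foldr (*) Bs (1\<^sub>m n)" "length Bs = t" "set Bs \<subseteq> set As"
        using A unfolding products_def by blast
      obtain w where w: "length w = t * length As" "block_output n As w 0 = A"
        using blocks_exist[OF As Bs(3)] Bs by auto
      have "row_sum_norm A \<le> row_sum_norm (foldr (*) (map (letter_mat n As) w) (1\<^sub>m ?N))"
        using automaton_mat_norm[of "block_output n As w" n "run (length As) w" "2 * length As"]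
          block_output_carrier[OF As(1)] block_output_blocks[OF As w(1)] products_carrier[OF As(1) A] As n w
        by (simp add: foldr_letter_mat[OF As])
      then show ?thesis using foldr_mem[of w] w(1) by auto
    qed
    show "\<exists>A\<in>products n (set As) t. norm l \<le> 1 ^ t * real_spectral_radius A"
      if t: "1 \<le> t" and W: "W \<in> products ?N ?S (t * length As)"
        and ev: "eigenvalue (map_mat complex_of_real W) l" and l: "l \<noteq> 0" for t W l
    proof -
      obtain w where "length w = t * length As" "W = foldr (*) (map (letter_mat n As) w) (1\<^sub>m ?N)"
        using foldr_ex[OF W] by blast
      then obtain A where A: "A \<in> products n (set As) t" "eigenvalue (map_mat complex_of_real A) l"
        using letter_mat_eigenvalue[OF As, of w t l] t ev l by blast
      have "norm l \<le> real_spectral_radius A"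
        using eigenvalue_le_real_spectral_radius[OF products_carrier[OF As(1) A(1)] A(2)] .
      then show ?thesis using A(1) by auto
    qed
    show "length As \<ge> 1" using As(2) by (cases As) auto
  qed (use As n fp letter_mat_carrier in \<open>auto simp: rng\<close>)
qed

section \<open>Combination of the two reductions\<close>

lemma common_denominator:
  assumes "finite X" "X \<subseteq> \<rat>"
  shows "\<exists>q::nat. q > 0 \<and> (\<forall>x\<in>X. real q * x \<in> \<int>)"
  using assms
proof (induction X)
  case empty
  then show ?case by (intro exI[of _ 1]) simp
next
  case (insert x X)
  then obtain q :: nat where q: "q > 0" "\<forall>x\<in>X. real q * x \<in> \<int>" by auto
  obtain a b where ab: "x = of_int a / of_int b" "b > 0" using insert.prems
    by (auto elim!: Rats_cases')
  have "real (q * nat b) * y \<in> \<int>" if y: "y \<in> insert x X" for y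
  proof (cases "y = x")
    case True
    then have "real (nat b) * y = of_int a" using ab by simp
    then have "real (q * nat b) * y = of_int (int q * a)" by (simp add: mult.assoc)
    then show ?thesis by (metis Ints_of_int)
  next
    case False
    then have "of_int b * (real q * y) \<in> \<int>" using q(2) y False by (intro Ints_mult[OF Ints_of_int]) auto
    then show ?thesis using ab by (simp add: mult_ac)
  qed
  then show ?case using q ab by (intro exI[of _ "q * nat b"]) auto
qed

lemma mat_with_entriesD:
  "A \<in> mat_with_entries n E \<Longrightarrow> A \<in> carrier_mat n n"
  "A \<in> mat_with_entries n E \<Longrightarrow> i < n \<Longrightarrow> j < n \<Longrightarrow> A $$ (i, j) \<in> E"
  unfolding mat_with_entries_def by (auto intro: elements_matI)

lemma mat_with_entriesI:
  assumes "A \<in> carrier_mat n n" "\<And>i j. i < n \<Longrightarrow> j < n \<Longrightarrow> A $$ (i, j) \<in> E"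
  shows "A \<in> mat_with_entries n E"
  using assms unfolding mat_with_entries_def by (auto dest!: elements_matD)

lemma mat_with_entries_mono: "E \<subseteq> F \<Longrightarrow> mat_with_entries n E \<subseteq> mat_with_entries n F"
  unfolding mat_with_entries_def by auto

lemma copy_mat_entries:
  assumes A: "A \<in> carrier_mat n n"
    and E: "0 \<in> E" "\<And>i j. i < n \<Longrightarrow> j < n \<Longrightarrow> sgn (q * A $$ (i, j)) \<in> E"
  shows "copy_mat q M A \<in> mat_with_entries (n * M) E"
proof (rule mat_with_entriesI[OF copy_mat_carrier[OF A]])
  fix r c assume "r < n * M" "c < n * M"
  then show "copy_mat q M A $$ (r, c) \<in> E"
    using A E(1) E(2)[of "r div M" "c div M"] div_mod_less(1)[of r n M] div_mod_less(1)[of c n M]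
    by (simp add: copy_mat_def)
qed

lemma letter_mat_entries:
  assumes As: "set As \<subseteq> mat_with_entries n E" and E: "0 \<in> E" "1 \<in> E"
  shows "letter_mat n As b \<in> mat_with_entries (2 * length As * n) E"
proof (rule mat_with_entriesI[OF letter_mat_carrier])
  fix r c assume rc: "r < 2 * length As * n" "c < 2 * length As * n"
  note d = div_mod_less[OF rc(1)] div_mod_less[OF rc(2)]
  have "label n As b s $$ (r mod n, c mod n) \<in> E" for s
  proof (cases "s < length As \<and> (b \<or> Suc s = length As)")
    case True
    then have "As ! s \<in> mat_with_entries n E" using As by auto
    from mat_with_entriesD(2)[OF this d(2,4)] show ?thesis using True by (simp add: label_def)
  next
    case False
    then show ?thesis using d E by (auto simp: label_def)
  qed
  then show "letter_mat n As b $$ (r, c) \<in> E"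
    using rc E by (simp add: letter_mat_def automaton_mat_def)
qed

text \<open>Copying comes first and yields entries in \<open>E\<close>; the letter matrices then
  keep entries in \<open>E\<close>. A general \<open>E\<close> covers both equivalences:
  \<open>{0, 1}\<close> for nonnegative entries, \<open>{0, 1, -1}\<close> for arbitrary
  ones.\<close>

lemma finiteness_property_reduction:
  assumes S: "finite S" "S \<noteq> {}" "S \<subseteq> mat_with_entries n \<rat>" and n: "n > 0"
    and E: "0 \<in> E" "1 \<in> E" "\<And>A i j. A \<in> S \<Longrightarrow> i < n \<Longrightarrow> j < n \<Longrightarrow> sgn (A $$ (i, j)) \<in> E"
    and pairs: "\<forall>n>0. \<forall>A \<in> mat_with_entries n E. \<forall>B \<in> mat_with_entries n E.
      finiteness_property n {A, B}"
  shows "finiteness_property n S"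
proof -
  have Sc: "S \<subseteq> carrier_mat n n" using S(3) mat_with_entriesD(1) by blast
  define X where "X = (\<lambda>(A, i, j). A $$ (i, j)) ` (S \<times> {..<n} \<times> {..<n})"
  have X: "finite X" "X \<subseteq> \<rat>" using S(1) by (auto simp: X_def intro!: mat_with_entriesD(2)[OF subsetD[OF S(3)]])
  have mem: "A $$ (i, j) \<in> X" if "A \<in> S" "i < n" "j < n" for A i j
    using that by (force simp: X_def)
  obtain q :: nat where q: "q > 0" "\<And>x. x \<in> X \<Longrightarrow> real q * x \<in> \<int>"
    using common_denominator[OF X] by blast
  have "bdd_above ((\<lambda>x. \<bar>real q * x\<bar>) ` X)" using X(1) by simp
  then obtain b where b: "\<And>x. x \<in> X \<Longrightarrow> \<bar>real q * x\<bar> \<le> b" unfolding bdd_above_def by auto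
  \<comment> \<open>One width \<open>M\<close> serves all entries of all matrices;
    \<open>Suc\<close> makes it positive.\<close>
  define M where "M = Suc (nat \<lceil>b\<rceil>)"
  have "b \<le> real M" unfolding M_def by linarith
  then have M: "M > 0" "\<And>x. x \<in> X \<Longrightarrow> \<bar>real q * x\<bar> \<le> real M"
    using b by (force simp: M_def)+
  obtain As where As: "set As = copy_mat q M ` S" using S(1) finite_list[of "copy_mat q M ` S"] by auto
  \<comment> \<open>Scaling by the positive \<open>q\<close> leaves signs unchanged, so the signs of
    the original entries decide.\<close>
  have entries: "set As \<subseteq> mat_with_entries (n * M) E"
    using copy_mat_entries[OF _ E(1)] E(3) Sc q(1) unfolding As by (auto simp: sgn_mult)
  have "finiteness_property (2 * length As * (n * M))
      {letter_mat (n * M) As False, letter_mat (n * M) As True}"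
    using pairs letter_mat_entries[OF entries E(1,2)] n M(1) As S(2) by (cases As) auto
  then have "finiteness_property (n * M) (set As)"
    using entries mat_with_entriesD(1) n M(1) As S(2)
    by (intro finiteness_property_letter_mat) auto
  then show ?thesis
    using finiteness_property_copy_mat[OF Sc S(1,2) n M(1), of "real q"] q mem M(2) As by auto
qed

theorem theorem4:
  shows "((\<forall>n>0. \<forall>S. finite S \<and> S \<noteq> {} \<and> S \<subseteq> mat_with_entries n {x \<in> \<rat>. 0 \<le> x}
              \<longrightarrow> finiteness_property n S)
          \<longleftrightarrow>
          (\<forall>n>0. \<forall>A \<in> mat_with_entries n {0, 1}. \<forall>B \<in> mat_with_entries n {0, 1}.
              finiteness_property n {A, B}))
       \<and> ((\<forall>n>0. \<forall>S. finite S \<and> S \<noteq> {} \<and> S \<subseteq> mat_with_entries n \<rat>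
              \<longrightarrow> finiteness_property n S)
          \<longleftrightarrow>
          (\<forall>n>0. \<forall>A \<in> mat_with_entries n {0, 1, -1}. \<forall>B \<in> mat_with_entries n {0, 1, -1}.
              finiteness_property n {A, B}))"
    (is "(?Q1 \<longleftrightarrow> ?B1) \<and> (?Q2 \<longleftrightarrow> ?B2)")
proof (intro conjI iffI)
  assume Q: ?Q1
  show ?B1
  proof (intro allI impI ballI)
    fix n :: nat and A B :: "real mat" assume "n > 0" "A \<in> mat_with_entries n {0, 1}" "B \<in> mat_with_entries n {0, 1}"
    moreover have "mat_with_entries n {0, 1} \<subseteq> mat_with_entries n {x \<in> \<rat>. 0 \<le> (x::real)}"
      by (intro mat_with_entries_mono) auto
    ultimately show "finiteness_property n {A, B}" using Q[rule_format, of n "{A, B}"] by blast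
  qed
next
  assume Q: ?Q2
  show ?B2
  proof (intro allI impI ballI)
    fix n :: nat and A B :: "real mat" assume "n > 0" "A \<in> mat_with_entries n {0, 1, -1}" "B \<in> mat_with_entries n {0, 1, -1}"
    moreover have "mat_with_entries n {0, 1, -1} \<subseteq> mat_with_entries n (\<rat> :: real set)"
      by (intro mat_with_entries_mono) auto
    ultimately show "finiteness_property n {A, B}" using Q[rule_format, of n "{A, B}"] by blast
  qed
next
  assume B: ?B1
  show ?Q1
  proof (intro allI impI)
    fix n :: nat and S assume n: "n > 0"
      and S: "finite S \<and> S \<noteq> {} \<and> S \<subseteq> mat_with_entries n {x \<in> \<rat>. 0 \<le> (x::real)}"
    have "S \<subseteq> mat_with_entries n \<rat>"
      using S mat_with_entries_mono[of "{x \<in> \<rat>. 0 \<le> (x::real)}" \<rat> n] by auto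
    \<comment> \<open>Nonnegative entries never have sign -1, which keeps the resulting pair
      binary.\<close>
    moreover have "sgn (A $$ (i, j)) \<in> {0, 1}" if "A \<in> S" "i < n" "j < n" for A i j
    proof -
      have "0 \<le> A $$ (i, j)" using S that mat_with_entriesD(2) by blast
      then show ?thesis by (auto simp: sgn_if)
    qed
    ultimately show "finiteness_property n S"
      using finiteness_property_reduction[of S n "{0, 1}"] S n B by blast
  qed
next
  assume B: ?B2
  show ?Q2
  proof (intro allI impI)
    fix n :: nat and S assume n: "n > 0"
      and S: "finite S \<and> S \<noteq> {} \<and> S \<subseteq> mat_with_entries n (\<rat> :: real set)"
    then show "finiteness_property n S"
      using finiteness_property_reduction[of S n "{0, 1, -1}"] B by (auto simp: sgn_if)
  qed
qed

end
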